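(* Let $k\geq 2$. Then $D(P_{3k,k})\leq \lfloor 3k/2\rfloor+2$.
   Context: For positive integers $n,k$ with $2\le 2k<n$, the generalised Petersen graph $P_{n,k}$ has vertex set $\{u_i,v_i: i\in\{0,\dots,n-1\}\}$ and edge set $\{u_iu_{i+1}, v_iv_{i+k}, u_iv_i : i\in\{0,\dots,n-1\}\}$, indices modulo $n$. A signed graph $(G,E_-)$ is a simple graph $G$ with a set $E_-\subseteq E(G)$ of negative edges; other edges are positive. A cycle is positive if the product of its edge signs is positive; a signed graph is balanced if every cycle is positive. The frustration index $l(G,E_-)$ is the minimum number of edges whose deletion leaves a balanced signed graph, and the maximum frustration is $D(G)=\max_{E_-\subseteq E(G)} l(G,E_-)$. *)

theory Defs
  imports Main
begin

text \<open>
  A graph is a pair of a vertex set and a set of edges, an edge being the two-element set of its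
  ends.
\<close>

type_synonym 'a graph = "'a set \<times> 'a set set"

definition verts :: "'a graph \<Rightarrow> 'a set" where
  "verts G = fst G"

definition edges :: "'a graph \<Rightarrow> 'a set set" where
  "edges G = snd G"

definition finite_simple_graph :: "'a graph \<Rightarrow> bool" where
  "finite_simple_graph G \<longleftrightarrow>
     finite (verts G) \<and> (\<forall>e\<in>edges G. e \<subseteq> verts G \<and> card e = 2)"

definition delete_edges :: "'a graph \<Rightarrow> 'a set set \<Rightarrow> 'a graph" where
  "delete_edges G F = (verts G, edges G - F)"

text \<open>
  A cycle is given by the cyclic list of its distinct vertices, the first one not being repeated
  at the end; its \<open>i\<close>-th edge joins the \<open>i\<close>-th vertex to its cyclic successor.
\<close>

definition cycle_edge :: "'a list \<Rightarrow> nat \<Rightarrow> 'a set" where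
  "cycle_edge c i = {c ! i, c ! (Suc i mod length c)}"

definition is_cycle :: "'a graph \<Rightarrow> 'a list \<Rightarrow> bool" where
  "is_cycle G c \<longleftrightarrow>
     3 \<le> length c \<and> distinct c \<and> set c \<subseteq> verts G \<and> (\<forall>i<length c. cycle_edge c i \<in> edges G)"

text \<open>In what follows, \<open>N\<close> is the set of negative edges of a signed graph \<open>(G, N)\<close>.\<close>

definition edge_sign :: "'a set set \<Rightarrow> 'a set \<Rightarrow> int" where
  "edge_sign N e = (if e \<in> N then - 1 else 1)"

definition positive_cycle :: "'a set set \<Rightarrow> 'a list \<Rightarrow> bool" where
  "positive_cycle N c \<longleftrightarrow> (\<Prod>i<length c. edge_sign N (cycle_edge c i)) > 0"

definition balanced :: "'a graph \<Rightarrow> 'a set set \<Rightarrow> bool" where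
  "balanced G N \<longleftrightarrow> (\<forall>c. is_cycle G c \<longrightarrow> positive_cycle N c)"

definition frustration_index :: "'a graph \<Rightarrow> 'a set set \<Rightarrow> nat" where
  "frustration_index G N =
     Min {card F |F. F \<subseteq> edges G \<and> balanced (delete_edges G F) (N - F)}"

definition max_frustration :: "'a graph \<Rightarrow> nat" where
  "max_frustration G = Max {frustration_index G N |N. N \<subseteq> edges G}"

text \<open>For a finite simple graph, the minimum and the maximum above are attained.\<close>

lemma finite_edges:
  assumes "finite_simple_graph G"
  shows "finite (edges G)"
proof (rule finite_subset)
  show "edges G \<subseteq> Pow (verts G)" "finite (Pow (verts G))"
    using assms by (auto simp: finite_simple_graph_def)
qed

lemma balanced_delete_all_edges: "balanced (delete_edges G (edges G)) N"
  by (fastforce simp: balanced_def is_cycle_def delete_edges_def edges_def)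

lemma frustration_index_attained:
  assumes "finite_simple_graph G"
  shows "\<exists>F\<subseteq>edges G. balanced (delete_edges G F) (N - F) \<and> card F = frustration_index G N"
proof -
  let ?S = "{card F |F. F \<subseteq> edges G \<and> balanced (delete_edges G F) (N - F)}"
  have "?S \<subseteq> card ` Pow (edges G)" by auto
  then have "finite ?S"
    using finite_edges[OF assms] by (meson finite_Pow_iff finite_imageI finite_subset)
  moreover have "?S \<noteq> {}" using balanced_delete_all_edges by blast
  ultimately have "Min ?S \<in> ?S" by (rule Min_in)
  then show ?thesis by (auto simp: frustration_index_def)
qed

lemma max_frustration_attained:
  assumes "finite_simple_graph G"
  shows "\<exists>N\<subseteq>edges G. frustration_index G N = max_frustration G"
proof -
  let ?S = "{frustration_index G N |N. N \<subseteq> edges G}"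
  have "?S = frustration_index G ` Pow (edges G)" by auto
  then have "finite ?S" using finite_edges[OF assms] by simp
  moreover have "?S \<noteq> {}" by blast
  ultimately have "Max ?S \<in> ?S" by (rule Max_in)
  then show ?thesis by (auto simp: max_frustration_def)
qed

datatype petersen_vertex = U nat | V nat

text \<open>The generalised Petersen graph is meant for \<open>2 \<le> 2 * k\<close> and \<open>2 * k < n\<close> only.\<close>

definition gen_petersen :: "nat \<Rightarrow> nat \<Rightarrow> petersen_vertex graph" where
  "gen_petersen n k =
     (U ` {..<n} \<union> V ` {..<n},
      {{U i, U ((i + 1) mod n)} |i. i < n} \<union>
      {{V i, V ((i + k) mod n)} |i. i < n} \<union>
      {{U i, V i} |i. i < n})"

lemma finite_simple_graph_gen_petersen:
  assumes "2 \<le> 2 * k" "2 * k < n"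
  shows "finite_simple_graph (gen_petersen n k)"
proof -
  have "i \<noteq> (i + j) mod n" if "i < n" "0 < j" "j < n" for i j
    using that by (cases "i + j < n") (auto simp: mod_if)
  from this[of _ 1] this[of _ k] show ?thesis
    using assms
    by (auto simp: finite_simple_graph_def gen_petersen_def verts_def edges_def card_2_iff
        doubleton_eq_iff)
qed

end

theory Submission
  imports Defs
begin

text \<open>
  The frustration index is at most the number of edges violated by any two-colouring of the
  vertices. Cut the outer cycle into three paths of length \<open>k\<close>, each meeting every inner triangle
  once, and colour each path so that all its edges are satisfied; such a colouring is unique up to
  a flip of the whole path. Keeping the first path fixed, there are four ways to flip the other
  two. Each of the three outer edges between the paths is violated in exactly two of them. Given
  the outer colours, every inner triangle can be coloured so that at most one of its edges and
  spokes is violated, except in at most one of the four cases, where two are. On average at most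
  \<open>(5 * k + 6) / 4\<close> edges are violated.
\<close>

section \<open>Two-colourings and balance\<close>

definition violated :: "'a set set \<Rightarrow> ('a \<Rightarrow> bool) \<Rightarrow> 'a set \<Rightarrow> bool" where
  "violated N c e \<longleftrightarrow> (\<exists>a b. e = {a, b} \<and> (c a \<noteq> c b) \<noteq> (e \<in> N))"

lemma violated_doubleton [simp]: "violated N c {a, b} \<longleftrightarrow> (c a \<noteq> c b) \<noteq> ({a, b} \<in> N)"
  unfolding violated_def by (auto simp: doubleton_eq_iff insert_commute)

lemma prod_cyclic_shift:
  fixes f :: "nat \<Rightarrow> 'b::comm_monoid_mult"
  shows "(\<Prod>i<n. f (Suc i mod n)) = (\<Prod>i<n. f i)"
proof (cases n)
  case (Suc m)
  have "(\<Prod>i<m. f (Suc i mod n)) = (\<Prod>i<m. f (Suc i))"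
    by (rule prod.cong) (auto simp: Suc)
  then have "(\<Prod>i<n. f (Suc i mod n)) = f 0 * (\<Prod>i<m. f (Suc i))"
    by (simp add: Suc mult.commute)
  also have "\<dots> = (\<Prod>i<n. f i)"
    unfolding Suc by (rule prod.lessThan_Suc_shift[symmetric])
  finally show ?thesis .
qed simp

text \<open>With colours read as signs, a surviving edge has the product of the signs of its two
  ends as its own sign. Around a cycle every vertex sign thus occurs twice.\<close>

lemma balanced_delete_violated:
  "balanced (delete_edges G {e \<in> edges G. violated N c e}) (N - {e \<in> edges G. violated N c e})"
  unfolding balanced_def
proof (intro allI impI)
  let ?F = "{e \<in> edges G. violated N c e}"
  fix xs
  assume cyc: "is_cycle (delete_edges G ?F) xs"
  define s :: "nat \<Rightarrow> int" where "s i = (if c (xs ! i) then - 1 else 1)" for i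
  let ?n = "length xs"
  have "edge_sign (N - ?F) (cycle_edge xs i) = s i * s (Suc i mod ?n)" if "i < ?n" for i
  proof -
    have "cycle_edge xs i \<in> edges G - ?F"
      using cyc that by (auto simp: is_cycle_def delete_edges_def edges_def)
    then show ?thesis
      by (auto simp: cycle_edge_def edge_sign_def s_def)
  qed
  then have "(\<Prod>i<?n. edge_sign (N - ?F) (cycle_edge xs i)) = (\<Prod>i<?n. s i * s (Suc i mod ?n))"
    by (intro prod.cong) auto
  also have "\<dots> = (\<Prod>i<?n. s i * s i)"
    by (simp add: prod.distrib prod_cyclic_shift)
  also have "\<dots> > 0"
    by (rule prod_pos) (simp add: s_def)
  finally show "positive_cycle (N - ?F) xs"
    by (simp add: positive_cycle_def)
qed

lemma frustration_index_le_violated: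
  assumes "finite_simple_graph G"
  shows "frustration_index G N \<le> card {e \<in> edges G. violated N c e}"
  unfolding frustration_index_def
proof (rule Min_le)
  have "{card F |F. F \<subseteq> edges G \<and> balanced (delete_edges G F) (N - F)} \<subseteq> card ` Pow (edges G)"
    by auto
  then show "finite {card F |F. F \<subseteq> edges G \<and> balanced (delete_edges G F) (N - F)}"
    using finite_edges[OF assms] by (meson finite_Pow_iff finite_imageI finite_subset)
  show "card {e \<in> edges G. violated N c e}
    \<in> {card F |F. F \<subseteq> edges G \<and> balanced (delete_edges G F) (N - F)}"
    using balanced_delete_violated[of G N c] by blast
qed

section \<open>Spokes and inner triangles\<close>

lemma card_filter_set_le: "card {x \<in> set xs. P x} \<le> length (filter P xs)"
  by (metis card_length set_filter)

text \<open>
  Here \<open>p\<^sub>j\<close> is the colour which the \<open>j\<close>-th spoke asks of its inner end when no path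
  is flipped, and \<open>b\<^sub>j\<close> tells which triangle edges are negative. In the exceptional case the triangle is negative and the spokes ask
  for a colouring which violates all three of its edges.
\<close>

lemma triangle_colouring:
  fixes p\<^sub>0 p\<^sub>1 p\<^sub>2 b\<^sub>0 b\<^sub>1 b\<^sub>2 :: bool
  shows "\<exists>\<alpha> \<beta>. \<forall>y z. \<exists>t\<^sub>0 t\<^sub>1 t\<^sub>2.
    (of_bool (t\<^sub>0 \<noteq> p\<^sub>0) + of_bool (t\<^sub>1 \<noteq> (y \<noteq> p\<^sub>1)) + of_bool (t\<^sub>2 \<noteq> (z \<noteq> p\<^sub>2))
     + of_bool ((t\<^sub>0 \<noteq> t\<^sub>1) \<noteq> b\<^sub>0) + of_bool ((t\<^sub>1 \<noteq> t\<^sub>2) \<noteq> b\<^sub>1) + of_bool ((t\<^sub>2 \<noteq> t\<^sub>0) \<noteq> b\<^sub>2) :: nat)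
    \<le> 1 + of_bool (y = \<alpha> \<and> z = \<beta>)"
  \<comment> \<open>The reason behind the case check: if the spokes are all obeyed, the number of
    violated triangle edges has the parity of the negative ones. Two violated edges share a vertex,
    and recolouring it costs one spoke and repairs both. Three are violated for exactly one choice
    of \<open>y\<close> and \<open>z\<close> in a negative triangle; recolouring one vertex then
    leaves one edge and one spoke. For a positive triangle \<open>\<alpha>\<close> and
    \<open>\<beta>\<close> are arbitrary.\<close>
  by (cases p\<^sub>0; cases p\<^sub>1; cases p\<^sub>2; cases b\<^sub>0; cases b\<^sub>1; cases b\<^sub>2)
     (simp_all add: ex_bool_eq all_bool_eq)

section \<open>The edges arranged by residue modulo \<open>k\<close>\<close>

lemma less_3k_cases:
  fixes i k :: nat
  assumes "i < 3 * k"
  obtains j where "j < k" "i = j" | j where "j < k" "i = j + k" | j where "j < k" "i = j + 2 * k"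
proof -
  consider "i < k" | "k \<le> i" "i < 2 * k" | "2 * k \<le> i" by linarith
  then show thesis
    using that(1)[of i] that(2)[of "i - k"] that(3)[of "i - 2 * k"] assms by cases auto
qed

text \<open>One recursion runs through all three paths without wrapping round, so before any flip
  the two joins at \<open>k\<close> and \<open>2 * k\<close> are satisfied as well.\<close>

primrec path_colouring :: "petersen_vertex set set \<Rightarrow> nat \<Rightarrow> bool" where
  "path_colouring N 0 = False"
| "path_colouring N (Suc i) = (path_colouring N i \<noteq> ({U i, U (Suc i)} \<in> N))"

text \<open>The indices congruent to \<open>i\<close> modulo \<open>k\<close> carry three spokes and
  one inner triangle; only the outer edges remain. An upper bound suffices, so no disjointness has
  to be shown.\<close>

lemma card_violated_gen_petersen_3k:
  fixes k :: nat
  assumes "k \<ge> 1"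
  shows "card {e \<in> edges (gen_petersen (3 * k) k). violated N c e}
    \<le> (\<Sum>i<k. length (filter (violated N c)
          [{U i, V i}, {U (i + k), V (i + k)}, {U (i + 2 * k), V (i + 2 * k)},
           {V i, V (i + k)}, {V (i + k), V (i + 2 * k)}, {V (i + 2 * k), V i}]))
      + card {i. i < 3 * k \<and> violated N c {U i, U (Suc i mod (3 * k))}}"
    (is "card ?B \<le> (\<Sum>i<k. length (filter _ (?es i))) + card ?O")
proof -
  have "e \<in> (\<Union>i<k. {e \<in> set (?es i). violated N c e}) \<union> (\<lambda>i. {U i, U (Suc i mod (3 * k))}) ` ?O"
    if "e \<in> ?B" for e
  proof -
    have v: "violated N c e" using that by simp
    have "e \<in> edges (gen_petersen (3 * k) k)" using that by simp
    then consider i where "i < 3 * k" "e = {U i, U (Suc i mod (3 * k))}"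
      | i where "i < 3 * k" "e = {V i, V ((i + k) mod (3 * k))}"
      | i where "i < 3 * k" "e = {U i, V i}"
      by (auto simp: gen_petersen_def edges_def)
    then show ?thesis
    proof cases
      case 1
      with v show ?thesis by blast
    next
      case (2 i)
      have "\<exists>j<k. e \<in> set (?es j)"
        using 2(1)
      proof (cases rule: less_3k_cases)
        case (1 j)
        with 2 show ?thesis by (intro exI[of _ j]) simp
      next
        case (2 j)
        with \<open>e = _\<close> show ?thesis by (intro exI[of _ j]) (simp add: mult_2 add.assoc)
      next
        case (3 j)
        then have "(i + k) mod (3 * k) = j" by (simp add: mod_if)
        with 3 \<open>e = _\<close> show ?thesis by (intro exI[of _ j]) simp
      qed
      with v show ?thesis by blast
    next
      case (3 i)
      have "\<exists>j<k. e \<in> set (?es j)"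
        using 3(1) by (cases rule: less_3k_cases) (use 3 in auto)
      with v show ?thesis by blast
    qed
  qed
  then have "card ?B \<le> card ((\<Union>i<k. {e \<in> set (?es i). violated N c e})
      \<union> (\<lambda>i. {U i, U (Suc i mod (3 * k))}) ` ?O)"
    by (intro card_mono subsetI) auto
  also have "\<dots> \<le> card (\<Union>i<k. {e \<in> set (?es i). violated N c e})
      + card ((\<lambda>i. {U i, U (Suc i mod (3 * k))}) ` ?O)"
    by (rule card_Un_le)
  also have "\<dots> \<le> (\<Sum>i<k. card {e \<in> set (?es i). violated N c e}) + card ?O"
    by (intro add_mono card_UN_le card_image_le) auto
  also have "\<dots> \<le> (\<Sum>i<k. length (filter (violated N c) (?es i))) + card ?O"
    by (intro add_mono sum_mono card_filter_set_le) auto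
  finally show ?thesis .
qed

section \<open>Averaging over the four flips\<close>

lemma frustration_index_gen_petersen_3k:
  fixes k :: nat
  assumes k: "k \<ge> 1"
  shows "4 * frustration_index (gen_petersen (3 * k) k) N \<le> 5 * k + 6"
proof -
  let ?G = "gen_petersen (3 * k) k"
  let ?w = "path_colouring N"
  \<comment> \<open>The exceptional flip of each triangle is fixed before \<open>y\<close> and
    \<open>z\<close>, so that it serves all four choices.\<close>
  have "\<forall>i. \<exists>\<alpha> \<beta>. \<forall>y z. \<exists>t\<^sub>0 t\<^sub>1 t\<^sub>2.
      (of_bool (t\<^sub>0 \<noteq> (?w i \<noteq> ({U i, V i} \<in> N)))
       + of_bool (t\<^sub>1 \<noteq> (y \<noteq> (?w (i + k) \<noteq> ({U (i + k), V (i + k)} \<in> N))))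
       + of_bool (t\<^sub>2 \<noteq> (z \<noteq> (?w (i + 2 * k) \<noteq> ({U (i + 2 * k), V (i + 2 * k)} \<in> N))))
       + of_bool ((t\<^sub>0 \<noteq> t\<^sub>1) \<noteq> ({V i, V (i + k)} \<in> N))
       + of_bool ((t\<^sub>1 \<noteq> t\<^sub>2) \<noteq> ({V (i + k), V (i + 2 * k)} \<in> N))
       + of_bool ((t\<^sub>2 \<noteq> t\<^sub>0) \<noteq> ({V (i + 2 * k), V i} \<in> N)) :: nat)
      \<le> 1 + of_bool (y = \<alpha> \<and> z = \<beta>)"
    by (intro allI triangle_colouring)
  then obtain \<alpha> \<beta> where ab: "\<And>i y z. \<exists>t\<^sub>0 t\<^sub>1 t\<^sub>2.
      (of_bool (t\<^sub>0 \<noteq> (?w i \<noteq> ({U i, V i} \<in> N)))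
       + of_bool (t\<^sub>1 \<noteq> (y \<noteq> (?w (i + k) \<noteq> ({U (i + k), V (i + k)} \<in> N))))
       + of_bool (t\<^sub>2 \<noteq> (z \<noteq> (?w (i + 2 * k) \<noteq> ({U (i + 2 * k), V (i + 2 * k)} \<in> N))))
       + of_bool ((t\<^sub>0 \<noteq> t\<^sub>1) \<noteq> ({V i, V (i + k)} \<in> N))
       + of_bool ((t\<^sub>1 \<noteq> t\<^sub>2) \<noteq> ({V (i + k), V (i + 2 * k)} \<in> N))
       + of_bool ((t\<^sub>2 \<noteq> t\<^sub>0) \<noteq> ({V (i + 2 * k), V i} \<in> N)) :: nat)
      \<le> 1 + of_bool (y = \<alpha> i \<and> z = \<beta> i)"
    by metis
  \<comment> \<open>As \<open>U 0\<close> has colour \<open>False\<close>, \<open>r\<close> says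
    that the closing outer edge is violated when nothing is flipped.\<close>
  define r where "r \<longleftrightarrow> ?w (3 * k - 1) \<noteq> ({U (3 * k - 1), U 0} \<in> N)"
  have bound: "frustration_index ?G N \<le>
      (\<Sum>i<k. 1 + of_bool (y = \<alpha> i \<and> z = \<beta> i)) + (of_bool y + of_bool (y \<noteq> z) + of_bool (z \<noteq> r))"
    for y z
  proof -
    obtain t\<^sub>0 t\<^sub>1 t\<^sub>2 where t: "\<And>i.
      (of_bool (t\<^sub>0 i \<noteq> (?w i \<noteq> ({U i, V i} \<in> N)))
       + of_bool (t\<^sub>1 i \<noteq> (y \<noteq> (?w (i + k) \<noteq> ({U (i + k), V (i + k)} \<in> N))))
       + of_bool (t\<^sub>2 i \<noteq> (z \<noteq> (?w (i + 2 * k) \<noteq> ({U (i + 2 * k), V (i + 2 * k)} \<in> N))))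
       + of_bool ((t\<^sub>0 i \<noteq> t\<^sub>1 i) \<noteq> ({V i, V (i + k)} \<in> N))
       + of_bool ((t\<^sub>1 i \<noteq> t\<^sub>2 i) \<noteq> ({V (i + k), V (i + 2 * k)} \<in> N))
       + of_bool ((t\<^sub>2 i \<noteq> t\<^sub>0 i) \<noteq> ({V (i + 2 * k), V i} \<in> N)) :: nat)
      \<le> 1 + of_bool (y = \<alpha> i \<and> z = \<beta> i)"
      using ab[of _ y z] by metis
    define c where "c v = (case v of
        U i \<Rightarrow> (if i < k then ?w i else if i < 2 * k then y \<noteq> ?w i else z \<noteq> ?w i)
      | V i \<Rightarrow> (if i < k then t\<^sub>0 i else if i < 2 * k then t\<^sub>1 (i - k) else t\<^sub>2 (i - 2 * k)))" for v
    have col: "length (filter (violated N c)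
          [{U i, V i}, {U (i + k), V (i + k)}, {U (i + 2 * k), V (i + 2 * k)},
           {V i, V (i + k)}, {V (i + k), V (i + 2 * k)}, {V (i + 2 * k), V i}])
        \<le> 1 + of_bool (y = \<alpha> i \<and> z = \<beta> i)" if "i < k" for i
    proof -
      have c: "c (U i) = ?w i" "c (U (i + k)) = (y \<noteq> ?w (i + k))"
        "c (U (i + 2 * k)) = (z \<noteq> ?w (i + 2 * k))"
        "c (V i) = t\<^sub>0 i" "c (V (i + k)) = t\<^sub>1 i" "c (V (i + 2 * k)) = t\<^sub>2 i"
        using that by (auto simp: c_def)
      have len: "length (filter P [e\<^sub>1, e\<^sub>2, e\<^sub>3, e\<^sub>4, e\<^sub>5, e\<^sub>6]) = of_bool (P e\<^sub>1) + of_bool (P e\<^sub>2)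
          + of_bool (P e\<^sub>3) + of_bool (P e\<^sub>4) + of_bool (P e\<^sub>5) + of_bool (P e\<^sub>6)"
        for P :: "petersen_vertex set \<Rightarrow> bool" and e\<^sub>1 e\<^sub>2 e\<^sub>3 e\<^sub>4 e\<^sub>5 e\<^sub>6
        by simp
      \<comment> \<open>Re-bracketing brings the violation of a spoke and the demand on its inner
        end to the same form.\<close>
      have xor: "((a \<noteq> b) \<noteq> d) = (b \<noteq> (a \<noteq> d))" "(((x \<noteq> a) \<noteq> b) \<noteq> d) = (b \<noteq> (x \<noteq> (a \<noteq> d)))"
        for a b d x :: bool
        by auto
      show ?thesis
        unfolding len violated_doubleton c
        using t[of i] unfolding xor by linarith
    qed
    have out: "card {i. i < 3 * k \<and> violated N c {U i, U (Suc i mod (3 * k))}}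
        \<le> of_bool y + of_bool (y \<noteq> z) + of_bool (z \<noteq> r)" (is "card ?O \<le> _")
    proof -
      have inner: "c (U i) \<noteq> c (U (Suc i)) \<longleftrightarrow> {U i, U (Suc i)} \<in> N"
        if "i < 3 * k" "i \<noteq> k - 1" "i \<noteq> 2 * k - 1" "i \<noteq> 3 * k - 1" for i
        using that by (auto simp: c_def)
      \<comment> \<open>Inside a path both ends of an edge are flipped alike. A join is violated
        according to the flips on its two sides, the first path having flip \<open>False\<close>,
        and at the closing edge also to \<open>r\<close>.\<close>
      have "?O \<subseteq> (if y then {k - 1} else {}) \<union> (if y \<noteq> z then {2 * k - 1} else {})
          \<union> (if z \<noteq> r then {3 * k - 1} else {})"
      proof
        fix i assume i: "i \<in> ?O"
        consider "i = k - 1" | "i = 2 * k - 1" | "i = 3 * k - 1"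
          | "i \<noteq> k - 1" "i \<noteq> 2 * k - 1" "i \<noteq> 3 * k - 1" by blast
        then show "i \<in> (if y then {k - 1} else {}) \<union> (if y \<noteq> z then {2 * k - 1} else {})
          \<union> (if z \<noteq> r then {3 * k - 1} else {})"
        proof cases
          case 1
          then have *: "Suc i = k" "i < k" using k by auto
          then have "?w k = (?w i \<noteq> ({U i, U k} \<in> N))"
            by (metis path_colouring.simps(2))
          moreover have "Suc i mod (3 * k) = k" "k < 2 * k" using * k by auto
          ultimately have "y" using i *(2) by (auto simp: c_def)
          with 1 show ?thesis by simp
        next
          case 2
          then have *: "Suc i = 2 * k" "\<not> i < k" "i < 2 * k" using k by auto
          then have "?w (2 * k) = (?w i \<noteq> ({U i, U (2 * k)} \<in> N))"
            by (metis path_colouring.simps(2))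
          moreover have "Suc i mod (3 * k) = 2 * k" using * k by auto
          ultimately have "y \<noteq> z" using i *(2,3) by (auto simp: c_def)
          with 2 show ?thesis by simp
        next
          case 3
          then have *: "Suc i = 3 * k" "\<not> i < k" "\<not> i < 2 * k" using k by auto
          then have "Suc i mod (3 * k) = 0" "r \<longleftrightarrow> ?w i \<noteq> ({U i, U 0} \<in> N)"
            using 3 by (simp_all add: r_def)
          then have "z \<noteq> r" using i k *(2,3) by (auto simp: c_def)
          with 3 show ?thesis by simp
        next
          case 4
          with i have "Suc i < 3 * k" by auto
          with i inner[of i] 4 show ?thesis by auto
        qed
      qed
      then have "card ?O \<le> card ((if y then {k - 1} else {}) \<union> (if y \<noteq> z then {2 * k - 1} else {})
          \<union> (if z \<noteq> r then {3 * k - 1} else {}))"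
        by (intro card_mono) auto
      also have "\<dots> \<le> of_bool y + of_bool (y \<noteq> z) + of_bool (z \<noteq> r)"
        by (intro order.trans[OF card_Un_le] add_mono) auto
      finally show ?thesis .
    qed
    have "frustration_index ?G N \<le> card {e \<in> edges ?G. violated N c e}"
      using k by (intro frustration_index_le_violated finite_simple_graph_gen_petersen) auto
    also note card_violated_gen_petersen_3k[OF k, of N c]
    also have "(\<Sum>i<k. length (filter (violated N c)
          [{U i, V i}, {U (i + k), V (i + k)}, {U (i + 2 * k), V (i + 2 * k)},
           {V i, V (i + k)}, {V (i + k), V (i + 2 * k)}, {V (i + 2 * k), V i}]))
        + card ?O \<le> (\<Sum>i<k. 1 + of_bool (y = \<alpha> i \<and> z = \<beta> i))
        + (of_bool y + of_bool (y \<noteq> z) + of_bool (z \<noteq> r))"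
      by (intro add_mono sum_mono col out) simp
    finally show ?thesis .
  qed
  \<comment> \<open>Each triangle is exceptional for exactly one of the four flips, hence
    \<open>4 + 1\<close>.\<close>
  have "(\<Sum>i<k. 1 + of_bool (False = \<alpha> i \<and> False = \<beta> i))
      + (\<Sum>i<k. 1 + of_bool (False = \<alpha> i \<and> True = \<beta> i))
      + (\<Sum>i<k. 1 + of_bool (True = \<alpha> i \<and> False = \<beta> i))
      + (\<Sum>i<k. 1 + of_bool (True = \<alpha> i \<and> True = \<beta> i))
      = (\<Sum>i<k. 5 :: nat)"
    unfolding sum.distrib[symmetric] by (rule sum.cong) auto
  \<comment> \<open>Whatever \<open>r\<close> is, each of \<open>y\<close>,
    \<open>y \<noteq> z\<close> and \<open>z \<noteq> r\<close> holds for two of the four flips,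
    which adds 6.\<close>
  then show ?thesis
    using bound[of False False] bound[of False True] bound[of True False] bound[of True True]
    by (cases r) simp_all
qed

theorem theorem4p2:
  fixes k :: nat
  assumes "k \<ge> 2"
  shows "max_frustration (gen_petersen (3 * k) k) \<le> (3 * k) div 2 + 2"
proof -
  have "finite_simple_graph (gen_petersen (3 * k) k)"
    using assms by (intro finite_simple_graph_gen_petersen) auto
  from max_frustration_attained[OF this] obtain N
    where "frustration_index (gen_petersen (3 * k) k) N = max_frustration (gen_petersen (3 * k) k)"
    by blast
  \<comment> \<open>Four times the claimed bound is at least
    \<open>2 * (3 * k - 1) + 8 = 6 * k + 6\<close>, which is at least
    \<open>5 * k + 6\<close>.\<close>
  with frustration_index_gen_petersen_3k[of k N] assms show ?thesis by linarith
qed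

end
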